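(* For every graph $G$, the zero sequence of the Laplacian matching polynomial $\beta(G,x)$ majorizes the degree sequence of $G$.
   Context: All graphs are finite, undirected, without loops or multiple edges. The Laplacian matching polynomial is $\beta(G,x)=\sum_{M\in\mathcal{M}(G)}(-1)^{|M|}\prod_{v\in V(G)\setminus V(M)}(x-d_G(v))$, where $\mathcal{M}(G)$ is the set of matchings including the empty set, $V(M)$ the set of endpoints of edges of $M$, and $d_G(v)$ the degree of $v$; it is real-rooted of degree $n=|V(G)|$, and its zero sequence is the vector in $\mathbb{R}^n$ of its zeros with multiplicity. For $\mathbf{x}\in\mathbb{R}^n$ let $\mathbf{x}_{[1]}\ge\dots\ge\mathbf{x}_{[n]}$ be its entries in nonincreasing order. $\mathbf{y}$ majorizes $\mathbf{x}$ if $\sum_{i=1}^k\mathbf{x}_{[i]}\le\sum_{i=1}^k\mathbf{y}_{[i]}$ for all $k=1,\dots,n$ and $\sum_{i=1}^n\mathbf{x}_i=\sum_{i=1}^n\mathbf{y}_i$. *)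

theory Defs
  imports
    Complex_Main
    "HOL-Library.Multiset"
    "HOL-Computational_Algebra.Polynomial"
begin

text \<open>An edge is the two-element set of its endpoints, so there are no loops and no multiple edges.\<close>

definition simple_graph :: "'a set \<Rightarrow> 'a set set \<Rightarrow> bool" where
  "simple_graph V E \<longleftrightarrow> finite V \<and> (\<forall>e\<in>E. e \<subseteq> V \<and> card e = 2)"

definition vertex_degree :: "'a set set \<Rightarrow> 'a \<Rightarrow> nat" where
  "vertex_degree E v = card {e \<in> E. v \<in> e}"

definition matchings :: "'a set set \<Rightarrow> 'a set set set" where
  "matchings E = {M. M \<subseteq> E \<and> pairwise disjnt M}"

definition laplacian_matching_poly :: "'a set \<Rightarrow> 'a set set \<Rightarrow> real poly" where
  "laplacian_matching_poly V E =
     (\<Sum>M\<in>matchings E. (-1) ^ card M * (\<Prod>v\<in>V - \<Union>M. [:- real (vertex_degree E v), 1:]))"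

text \<open>
  Majorization does not depend on the order of the entries of a vector, so a vector with \<open>n\<close> real
  entries is represented by the multiset of size \<open>n\<close> of its entries.
\<close>

definition degree_sequence :: "'a set \<Rightarrow> 'a set set \<Rightarrow> real multiset" where
  "degree_sequence V E = image_mset (\<lambda>v. real (vertex_degree E v)) (mset_set V)"

definition zero_sequence :: "real poly \<Rightarrow> real multiset" where
  "zero_sequence p = proots p"

definition nonincreasing :: "real multiset \<Rightarrow> real list" where
  "nonincreasing X = rev (sorted_list_of_multiset X)"

text \<open>
  The first conjunct says that both vectors have the same dimension. For the zero sequence of a
  polynomial of degree \<open>n\<close> and a vector of dimension \<open>n\<close> it amounts to real-rootedness of the
  polynomial, since \<^const>\<open>zero_sequence\<close> only collects the real zeros.
\<close>

definition majorizes :: "real multiset \<Rightarrow> real multiset \<Rightarrow> bool" where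
  "majorizes Y X \<longleftrightarrow>
     size X = size Y \<and>
     (\<forall>k\<in>{1..size X}. sum_list (take k (nonincreasing X)) \<le> sum_list (take k (nonincreasing Y))) \<and>
     sum_mset X = sum_mset Y"

end

(* Weight the vertices by arbitrary reals d and let P T be the corresponding matching polynomial of
   the subgraph induced by T. The recurrence for P at a vertex v and induction show that
   P T / P (T - v) maps the upper half-plane into itself. Hence P T is real-rooted, and a comparison
   of arguments along a vertical ray shows that the i-th largest zero of P T is at least the i-th
   largest zero of P (T - v). If S consists of k vertices of largest weight, the sum of the weights
   on S is the sum of all zeros of P S, which is therefore at most the sum of the k largest zeros of
   P V; for S = V it is equality. *)

theory Submission
  imports Defs "HOL-Computational_Algebra.Fundamental_Theorem_Algebra"
begin

section \<open>Weighted matching polynomials and the vertex recurrence\<close>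

definition matchings_in :: "'a set set \<Rightarrow> 'a set \<Rightarrow> 'a set set set" where
  "matchings_in E T = {M \<in> matchings E. \<Union>M \<subseteq> T}"

text \<open>The weight \<open>d\<close> replaces the degree because degrees in an induced subgraph
  change when a vertex is deleted; with \<open>d\<close> fixed, the family is closed under
  deletion.\<close>

definition weighted_matching_poly :: "('a \<Rightarrow> 'b::comm_ring_1) \<Rightarrow> 'a set set \<Rightarrow> 'a set \<Rightarrow> 'b poly" where
  "weighted_matching_poly d E T =
     (\<Sum>M\<in>matchings_in E T. (-1) ^ card M * (\<Prod>v\<in>T - \<Union>M. [:- d v, 1:]))"

lemma finite_matchings_in: "finite E \<Longrightarrow> finite (matchings_in E T)"
  by (rule finite_subset[of _ "Pow E"]) (auto simp: matchings_in_def matchings_def)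

text \<open>A matching that covers \<open>v\<close> has exactly one edge at \<open>v\<close>;
  removing this edge leaves a matching that avoids both of its ends.\<close>

lemma matchings_in_covering:
  assumes "v \<notin> T" and card2: "\<forall>e\<in>E. card e = 2"
  shows "bij_betw (\<lambda>(u, M). insert {u, v} M)
           (SIGMA u:{u \<in> T. {u, v} \<in> E}. matchings_in E (T - {u}))
           {M \<in> matchings_in E (insert v T). v \<in> \<Union>M}"
  unfolding bij_betw_def
proof
  show "inj_on (\<lambda>(u, M). insert {u, v} M) (SIGMA u:{u \<in> T. {u, v} \<in> E}. matchings_in E (T - {u}))"
  proof (rule inj_onI, clarify)
    fix u M u' M'
    assume u: "u \<in> T" "u' \<in> T" and M: "M \<in> matchings_in E (T - {u})" "M' \<in> matchings_in E (T - {u'})"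
      and eq: "insert {u, v} M = insert {u', v} M'"
    have nv: "\<forall>e\<in>M \<union> M'. v \<notin> e" using M assms(1) by (auto simp: matchings_in_def)
    have "{u, v} = {u', v}" using eq nv by blast
    then have "u = u'" by (metis doubleton_eq_iff)
    moreover have "M = M'" using eq nv \<open>u = u'\<close> by blast
    ultimately show "u = u' \<and> M = M'" by simp
  qed
  show "(\<lambda>(u, M). insert {u, v} M) ` (SIGMA u:{u \<in> T. {u, v} \<in> E}. matchings_in E (T - {u}))
      = {M \<in> matchings_in E (insert v T). v \<in> \<Union>M}" (is "?L = ?R")
  proof (intro equalityI subsetI)
    fix N assume "N \<in> ?L"
    then obtain u M where "u \<in> T" "{u, v} \<in> E" "M \<in> matchings_in E (T - {u})" and N: "N = insert {u, v} M"
      by auto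
    then have "M \<subseteq> E" "pairwise disjnt M" "\<Union>M \<subseteq> T - {u}"
      by (auto simp: matchings_in_def matchings_def)
    moreover have "\<forall>e\<in>M. disjnt {u, v} e \<and> disjnt e {u, v}"
      using \<open>\<Union>M \<subseteq> T - {u}\<close> assms(1) by (auto simp: disjnt_def)
    ultimately show "N \<in> ?R" using \<open>u \<in> T\<close> \<open>{u, v} \<in> E\<close> N
      by (auto simp: matchings_in_def matchings_def pairwise_insert)
  next
    fix N assume "N \<in> ?R"
    then have N: "N \<subseteq> E" "pairwise disjnt N" "\<Union>N \<subseteq> insert v T" "v \<in> \<Union>N"
      by (auto simp: matchings_in_def matchings_def)
    then obtain e where e: "e \<in> N" "v \<in> e" by blast
    then have "card e = 2" using card2 N by blast
    then obtain u where u: "e = {u, v}" "u \<noteq> v"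
      using e(2) by (auto simp: card_2_iff)
    have uT: "u \<in> T" using u e N by auto
    have "u \<notin> e' \<and> v \<notin> e'" if "e' \<in> N - {e}" for e'
    proof -
      have "disjnt e' e" using N(2) e(1) that by (auto dest: pairwiseD)
      then show ?thesis by (simp add: u(1) disjnt_def)
    qed
    then have "\<Union>(N - {e}) \<subseteq> T - {u}" using N(3) by blast
    moreover have "pairwise disjnt (N - {e})" by (rule pairwise_subset[OF N(2)]) blast
    ultimately have "N - {e} \<in> matchings_in E (T - {u})"
      using N(1) by (auto simp: matchings_in_def matchings_def)
    moreover have "N = insert {u, v} (N - {e})" using u e by auto
    moreover have "{u, v} \<in> E" using u e N by blast
    ultimately have "(u, N - {e}) \<in> (SIGMA u:{u \<in> T. {u, v} \<in> E}. matchings_in E (T - {u}))"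
      and "N = (\<lambda>(u, M). insert {u, v} M) (u, N - {e})"
      using uT by simp_all
    then show "N \<in> ?L" by (rule rev_image_eqI)
  qed
qed

text \<open>Matchings that avoid \<open>v\<close> contribute the factor \<open>[:- d v, 1:]\<close>;
  those that cover it are indexed by the partner \<open>u\<close> of \<open>v\<close>, and the
  removed edge accounts for the minus sign.\<close>

lemma weighted_matching_poly_insert:
  assumes "finite E" "\<forall>e\<in>E. card e = 2" "finite T" "v \<notin> T"
  shows "weighted_matching_poly d E (insert v T) =
    [:- d v, 1:] * weighted_matching_poly d E T
    - (\<Sum>u\<in>{u \<in> T. {u, v} \<in> E}. weighted_matching_poly d E (T - {u}))"
proof -
  define f where "f T M = (-1) ^ card M * (\<Prod>v\<in>T - \<Union>M. [:- d v, 1:])" for T and M :: "'a set set"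
  let ?A = "matchings_in E (insert v T)"
  have fin: "finite ?A" "\<And>T. finite (matchings_in E T)" using assms(1) by (simp_all add: finite_matchings_in)
  have "weighted_matching_poly d E (insert v T) = sum (f (insert v T)) ?A"
    by (simp add: weighted_matching_poly_def f_def)
  also have "?A = matchings_in E T \<union> {M \<in> ?A. v \<in> \<Union>M}"
    by (auto simp: matchings_in_def)
  also have "sum (f (insert v T)) \<dots> = sum (f (insert v T)) (matchings_in E T)
      + sum (f (insert v T)) {M \<in> ?A. v \<in> \<Union>M}"
  proof (rule sum.union_disjoint)
    show "finite {M \<in> ?A. v \<in> \<Union>M}" using fin(1) by simp
  qed (use fin assms(4) in \<open>auto simp: matchings_in_def\<close>)
  also have "sum (f (insert v T)) (matchings_in E T) = (\<Sum>M\<in>matchings_in E T. [:- d v, 1:] * f T M)"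
  proof (rule sum.cong[OF refl])
    fix M assume "M \<in> matchings_in E T"
    then have "insert v T - \<Union>M = insert v (T - \<Union>M)" "v \<notin> T - \<Union>M"
      using assms(4) by (auto simp: matchings_in_def)
    then show "f (insert v T) M = [:- d v, 1:] * f T M"
      using assms(3) by (simp add: f_def algebra_simps del: mult_pCons_left mult_pCons_right)
  qed
  also have "\<dots> = [:- d v, 1:] * weighted_matching_poly d E T"
    by (simp only: sum_distrib_left weighted_matching_poly_def f_def)
  also have "sum (f (insert v T)) {M \<in> ?A. v \<in> \<Union>M}
      = (\<Sum>(u, M)\<in>(SIGMA u:{u \<in> T. {u, v} \<in> E}. matchings_in E (T - {u})). - f (T - {u}) M)"
  proof (subst sum.reindex_bij_betw[OF matchings_in_covering[OF assms(4,2)], symmetric],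
      rule sum.cong[OF refl], clarify)
    fix u M assume u: "u \<in> T" and M: "M \<in> matchings_in E (T - {u})"
    have "finite M" using M assms(1) finite_subset by (auto simp: matchings_in_def matchings_def)
    moreover have "{u, v} \<notin> M" using M by (auto simp: matchings_in_def)
    moreover have "insert v T - \<Union>(insert {u, v} M) = T - {u} - \<Union>M"
      using u assms(4) by auto
    ultimately show "f (insert v T) (insert {u, v} M) = - f (T - {u}) M"
      by (simp add: f_def)
  qed
  also have "\<dots> = (\<Sum>u\<in>{u \<in> T. {u, v} \<in> E}. - weighted_matching_poly d E (T - {u}))"
    using assms(3) fin(2)
    by (simp add: sum.Sigma[symmetric] sum_negf weighted_matching_poly_def f_def)
  finally show ?thesis by (simp add: sum_negf)
qed

lemma weighted_matching_poly_empty: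
  assumes "\<forall>e\<in>E. card e = 2"
  shows "weighted_matching_poly d E {} = 1"
proof -
  have "matchings_in E {} = {{}}"
  proof (intro equalityI subsetI)
    fix M assume "M \<in> matchings_in E {}"
    then have "\<forall>e\<in>M. e = {} \<and> card e = 2" using assms by (auto simp: matchings_in_def matchings_def)
    then show "M \<in> {{}}" by fastforce
  qed (auto simp: matchings_in_def matchings_def)
  then show ?thesis by (simp add: weighted_matching_poly_def)
qed

text \<open>All edges of a simple graph lie in \<open>V\<close>, so the restriction to matchings
  inside \<open>V\<close> excludes none.\<close>

lemma laplacian_matching_poly_eq_weighted:
  assumes "simple_graph V E"
  shows "laplacian_matching_poly V E = weighted_matching_poly (\<lambda>v. real (vertex_degree E v)) E V"
proof -
  have "matchings_in E V = matchings E"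
    using assms by (fastforce simp: matchings_in_def matchings_def simple_graph_def)
  then show ?thesis by (simp add: laplacian_matching_poly_def weighted_matching_poly_def)
qed

section \<open>Degree and top two coefficients\<close>

text \<open>These data determine the number and the sum of the zeros. The last claim excludes the
  empty set, where \<open>card T - 1\<close> truncates to 0 and the coefficient is 1.\<close>

lemma weighted_matching_poly_coeffs:
  fixes d :: "'a \<Rightarrow> real"
  assumes "finite E" "\<forall>e\<in>E. card e = 2" "finite T"
  shows "degree (weighted_matching_poly d E T) = card T \<and>
         coeff (weighted_matching_poly d E T) (card T) = 1 \<and>
         (T \<noteq> {} \<longrightarrow> coeff (weighted_matching_poly d E T) (card T - 1) = - sum d T)"
  using assms(3)
proof (induction "card T" arbitrary: T rule: less_induct)
  case less
  show ?case
  proof (cases "T = {}")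
    case True
    then show ?thesis using assms by (simp add: weighted_matching_poly_empty)
  next
    case False
    then obtain v where v: "v \<in> T" by blast
    define S where "S = T - {v}"
    have "card T = Suc (card S)" unfolding S_def by (rule card.remove[OF less.prems v])
    then have T: "T = insert v S" "v \<notin> S" "finite S" "card T = Suc (card S)"
      using v less.prems by (auto simp: S_def)
    let ?p = "weighted_matching_poly d E"
    let ?R = "\<Sum>u\<in>{u \<in> S. {u, v} \<in> E}. ?p (S - {u})"
    note S = less.hyps[of S, unfolded T(4), OF lessI T(3)]
    \<comment> \<open>Each neighbour term has degree below \<open>card S\<close>, so it affects
      neither of the two coefficients in question.\<close>
    have R: "coeff ?R j = 0" if "card S \<le> j" for j
    proof -
      have "coeff (?p (S - {u})) j = 0" if "u \<in> S" for u
      proof (rule coeff_eq_0)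
        have "card (S - {u}) < card S" using that T(3) by (metis card_Diff1_less)
        then show "degree (?p (S - {u})) < j"
          using less.hyps[of "S - {u}"] T \<open>card S \<le> j\<close> by simp
      qed
      then show ?thesis by (simp add: coeff_sum)
    qed
    have eq: "?p T = [:- d v, 1:] * ?p S - ?R"
      using weighted_matching_poly_insert[OF assms(1,2) T(3,2)] T(1) by simp
    have c: "coeff (?p T) (Suc j) = coeff (?p S) j - d v * coeff (?p S) (Suc j)" if "card S \<le> Suc j" for j
      using R[OF that] by (simp add: eq)
    have c1: "coeff (?p T) (card T) = 1" using S c[of "card S"] T(4) by (simp add: coeff_eq_0)
    have "coeff (?p T) j = 0" if "card T < j" for j
      using that S c[of "j - 1"] T(4) by (cases j) (auto simp: coeff_eq_0)
    then have deg: "degree (?p T) = card T"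
      using c1 by (metis degree_le le_antisym le_degree zero_neq_one)
    \<comment> \<open>For empty \<open>S\<close> the index is 0, which is not of the form
      \<open>Suc j\<close> treated by \<open>c\<close>.\<close>
    have "coeff (?p T) (card S) = - sum d T"
    proof (cases "S = {}")
      case True
      moreover have "coeff (?p T) 0 = - d v * coeff (?p S) 0 - coeff ?R 0" by (simp add: eq)
      ultimately show ?thesis using S T by simp
    next
      case False
      then obtain k where "card S = Suc k" using T(3) by (metis card_0_eq not0_implies_Suc)
      then show ?thesis using c[of k] S False T by simp
    qed
    then show ?thesis using c1 deg T(4) by simp
  qed
qed

section \<open>The upper half-plane and real-rootedness\<close>

lemma map_poly_of_real_mult:
  "map_poly complex_of_real (p * q) = map_poly of_real p * map_poly of_real q"
  by (rule poly_eqI) (simp add: coeff_map_poly coeff_mult)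

lemma map_poly_of_real_diff:
  "map_poly complex_of_real (p - q) = map_poly of_real p - map_poly of_real q"
  by (rule poly_eqI) (simp add: coeff_map_poly)

lemma map_poly_of_real_sum:
  "map_poly complex_of_real (sum f A) = (\<Sum>x\<in>A. map_poly of_real (f x))"
  by (rule poly_eqI) (simp add: coeff_map_poly coeff_sum)

abbreviation cpoly :: "real poly \<Rightarrow> complex \<Rightarrow> complex" where
  "cpoly p \<equiv> poly (map_poly complex_of_real p)"

text \<open>The two claims support each other: nonvanishing on smaller sets allows the recurrence to
  be divided by the polynomial of \<open>T - {v}\<close>, and a quotient with positive imaginary
  part forces a nonzero numerator.\<close>

lemma weighted_matching_poly_Im_pos:
  fixes d :: "'a \<Rightarrow> real"
  assumes "finite E" "\<forall>e\<in>E. card e = 2" "finite T" "Im z > 0"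
  shows "cpoly (weighted_matching_poly d E T) z \<noteq> 0 \<and>
    (\<forall>v\<in>T. Im (cpoly (weighted_matching_poly d E T) z
               / cpoly (weighted_matching_poly d E (T - {v})) z) > 0)"
  using assms(3)
proof (induction "card T" arbitrary: T rule: less_induct)
  case less
  let ?p = "\<lambda>T. cpoly (weighted_matching_poly d E T) z"
  have Im: "Im (?p T / ?p (T - {v})) > 0" if v: "v \<in> T" for v
  proof -
    define S where "S = T - {v}"
    have "card T = Suc (card S)" unfolding S_def by (rule card.remove[OF less.prems v])
    then have T: "T = insert v S" "v \<notin> S" "finite S" "card T = Suc (card S)"
      using v less.prems by (auto simp: S_def)
    note IH = less.hyps[of S, unfolded T(4), OF lessI T(3)]
    have "?p T = (z - d v) * ?p S - (\<Sum>u\<in>{u \<in> S. {u, v} \<in> E}. ?p (S - {u}))"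
      unfolding T(1) weighted_matching_poly_insert[OF assms(1,2) T(3,2)]
      by (simp add: map_poly_of_real_mult map_poly_of_real_diff map_poly_of_real_sum
          poly_sum map_poly_pCons left_diff_distrib del: mult_pCons_left)
    then have "?p T / ?p S = z - d v - (\<Sum>u\<in>{u \<in> S. {u, v} \<in> E}. inverse (?p S / ?p (S - {u})))"
      using IH by (simp add: diff_divide_distrib sum_divide_distrib)
    \<comment> \<open>Inversion sends the upper half-plane to the lower one, so subtracting these
      terms cannot decrease the imaginary part.\<close>
    moreover have "Im (inverse (?p S / ?p (S - {u}))) \<le> 0" if "u \<in> S" for u
    proof -
      have "Im (?p S / ?p (S - {u})) > 0" using IH that by blast
      then show ?thesis by (simp only: inverse_complex.simps) (simp add: divide_nonpos_nonneg)
    qed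
    ultimately have "Im (?p T / ?p S) \<ge> Im z"
      by (auto intro!: sum_nonpos)
    then show ?thesis using assms(4) by (simp add: S_def)
  qed
  show ?case
  proof (cases "T = {}")
    case True
    then show ?thesis using assms by (simp add: weighted_matching_poly_empty)
  next
    case False
    then obtain v where "v \<in> T" by blast
    then have "?p T \<noteq> 0" using Im[of v] by auto
    then show ?thesis using Im by blast
  qed
qed

text \<open>Nonreal zeros of a real polynomial come in conjugate pairs, so nonvanishing above the
  real axis makes every complex zero real, and its linear factor splits off. The conclusion says
  that \<open>proots\<close>, which collects real zeros only, misses none.\<close>

lemma real_rooted_decompose:
  fixes p :: "real poly"
  assumes "p \<noteq> 0" "\<And>z. Im z > 0 \<Longrightarrow> cpoly p z \<noteq> 0"
  shows "p = smult (lead_coeff p) (\<Prod>a\<in>#proots p. [:- a, 1:])"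
  using assms
proof (induction "degree p" arbitrary: p rule: less_induct)
  case less
  show ?case
  proof (cases "degree p = 0")
    case True
    then obtain c where "p = [:c:]" by (metis degree_0_id)
    then show ?thesis by simp
  next
    case False
    then have "\<not> constant (cpoly p)"
      by (metis constant_degree degree_map_poly of_real_eq_0_iff)
    then obtain z where z: "cpoly p z = 0" using fundamental_theorem_of_algebra by blast
    have "cpoly p (cnj z) = cnj (cpoly p z)"
      by (simp add: poly_altdef coeff_map_poly degree_map_poly)
    then have "Im z = 0" using z less.prems(2)[of z] less.prems(2)[of "cnj z"] by
      (cases "Im z" "0::real" rule: linorder_cases) auto
    then have "z = of_real (Re z)" by (simp add: complex_eq_iff)
    then have "cpoly p (of_real (Re z)) = 0" using z by simp
    then have "complex_of_real (poly p (Re z)) = 0"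
      by (simp add: poly_altdef coeff_map_poly degree_map_poly)
    then have "[:- Re z, 1:] dvd p" by (simp add: poly_eq_0_iff_dvd)
    then obtain q where q: "p = [:- Re z, 1:] * q" by (elim dvdE)
    then have "q \<noteq> 0" using less.prems(1) by auto
    then have "degree q < degree p" using q by (simp add: degree_mult_eq del: mult_pCons_left)
    moreover have "cpoly q w \<noteq> 0" if "Im w > 0" for w
      using less.prems(2)[OF that] by (auto simp: q map_poly_of_real_mult simp del: mult_pCons_left)
    ultimately have "q = smult (lead_coeff q) (\<Prod>a\<in>#proots q. [:- a, 1:])"
      using less.hyps \<open>q \<noteq> 0\<close> by blast
    moreover have "proots p = add_mset (Re z) (proots q)"
      using \<open>q \<noteq> 0\<close> by (simp add: q proots_mult del: mult_pCons_left)
    moreover have "lead_coeff p = lead_coeff q" by (simp add: q lead_coeff_mult del: mult_pCons_left)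
    ultimately show ?thesis using q by (metis image_mset_add_mset prod_mset.add_mset mult_smult_right)
  qed
qed

section \<open>Arguments of products along a vertical ray\<close>

text \<open>The argument of \<open>s (t - a) + \<i>\<close>.\<close>

definition root_angle :: "real \<Rightarrow> real \<Rightarrow> real \<Rightarrow> real" where
  "root_angle s t a = pi / 2 - arctan (s * (t - a))"

text \<open>Multiplying by \<open>s > 0\<close> turns \<open>t + \<i> / s - a\<close> into
  \<open>s * (t - a) + \<i>\<close> and keeps the argument. With height \<open>1 / s\<close> the
  angle extends continuously to \<open>s = 0\<close>, the infinite end of the ray.\<close>

lemma cis_root_angle:
  assumes "s > 0"
  obtains r where "r > 0" "Complex t (1 / s) - complex_of_real a = of_real r * cis (root_angle s t a)"
proof
  let ?u = "s * (t - a)"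
  have pos: "sqrt (1 + ?u\<^sup>2) > 0" by (simp add: add_pos_nonneg)
  show "sqrt (1 + ?u\<^sup>2) / s > 0" using pos assms by simp
  show "Complex t (1 / s) - complex_of_real a = of_real (sqrt (1 + ?u\<^sup>2) / s) * cis (root_angle s t a)"
    using assms pos by (simp add: complex_eq_iff root_angle_def cos_diff sin_diff cos_arctan sin_arctan)
qed

text \<open>Arguments add under multiplication. Their sum is not reduced modulo
  \<open>2 * pi\<close>, so that it can be followed continuously in \<open>s\<close>.\<close>

lemma cis_sum_root_angle:
  assumes "s > 0"
  shows "\<exists>r>0. cpoly (\<Prod>a\<in>#A. [:- a, 1:]) (Complex t (1 / s))
    = of_real r * cis (\<Sum>a\<in>#A. root_angle s t a)"
proof (induction A)
  case empty
  then show ?case by (intro exI[of _ 1]) simp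
next
  case (add a A)
  let ?z = "Complex t (1 / s)"
  obtain r where "r > 0" "cpoly (\<Prod>a\<in>#A. [:- a, 1:]) ?z = of_real r * cis (\<Sum>a\<in>#A. root_angle s t a)"
    using add by blast
  moreover obtain r' where "r' > 0" "?z - of_real a = of_real r' * cis (root_angle s t a)"
    using cis_root_angle[OF assms] by blast
  moreover have "cpoly (\<Prod>a\<in>#add_mset a A. [:- a, 1:]) ?z
      = (?z - of_real a) * cpoly (\<Prod>a\<in>#A. [:- a, 1:]) ?z"
    by (simp add: map_poly_of_real_mult map_poly_pCons del: mult_pCons_left)
  ultimately show ?case
    by (intro exI[of _ "r' * r"]) (simp add: cis_mult[symmetric])
qed

text \<open>In the limit the angle is the argument of the real number \<open>t - a\<close>; for
  \<open>a = t\<close> it would stay at \<open>pi / 2\<close>.\<close>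

lemma root_angle_tendsto:
  assumes "a \<noteq> t"
  shows "((\<lambda>s. root_angle s t a) \<longlongrightarrow> (if a > t then pi else 0)) at_top"
proof (cases "a > t")
  case True
  then have "filterlim (\<lambda>s. (t - a) * s) at_bot at_top"
    by (simp add: filterlim_tendsto_neg_mult_at_bot[OF tendsto_const _ filterlim_ident])
  then have "((\<lambda>s. arctan (s * (t - a))) \<longlongrightarrow> - (pi / 2)) at_top"
    using filterlim_compose[OF tendsto_arctan_at_bot] by (simp add: mult.commute)
  from tendsto_diff[OF tendsto_const this] have "((\<lambda>s. root_angle s t a) \<longlongrightarrow> pi / 2 - - (pi / 2)) at_top"
    unfolding root_angle_def .
  then show ?thesis using True by simp
next
  case False
  then have "filterlim (\<lambda>s. (t - a) * s) at_top at_top"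
    using assms by (simp add: filterlim_tendsto_pos_mult_at_top[OF tendsto_const _ filterlim_ident])
  then have "((\<lambda>s. arctan (s * (t - a))) \<longlongrightarrow> pi / 2) at_top"
    using filterlim_compose[OF tendsto_arctan_at_top] by (simp add: mult.commute)
  from tendsto_diff[OF tendsto_const this] have "((\<lambda>s. root_angle s t a) \<longlongrightarrow> pi / 2 - pi / 2) at_top"
    unfolding root_angle_def .
  then show ?thesis using False by simp
qed

lemma sum_root_angle_tendsto:
  assumes "t \<notin># A"
  shows "((\<lambda>s. \<Sum>a\<in>#A. root_angle s t a) \<longlongrightarrow> pi * size (filter_mset (\<lambda>a. a > t) A)) at_top"
  using assms
proof (induction A)
  case (add a A)
  then have "((\<lambda>s. root_angle s t a + (\<Sum>a\<in>#A. root_angle s t a))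
      \<longlongrightarrow> (if a > t then pi else 0) + pi * size (filter_mset (\<lambda>a. a > t) A)) at_top"
    by (intro tendsto_add root_angle_tendsto) auto
  then show ?case by (simp add: algebra_simps split: if_splits)
qed simp

lemma continuous_on_sum_root_angle:
  "continuous_on S (\<lambda>s. \<Sum>a\<in>#A. root_angle s t a)"
  by (induction A) (auto simp: root_angle_def intro!: continuous_intros)

text \<open>As \<open>s\<close> runs from \<open>0\<close> to infinity, the argument of the quotient of the two products at \<open>t + \<i> / s\<close>, followed
  continuously, starts at \<open>\<pi> / 2\<close> and tends to \<open>\<pi>\<close> times the difference of the two counts;
  it cannot cross \<open>0\<close> because the quotient is nonreal in the upper half-plane.\<close>

lemma count_roots_mono:
  assumes size: "size A = Suc (size B)" and t: "t \<notin># A" "t \<notin># B"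
    and Im: "\<And>z. Im z > 0 \<Longrightarrow>
      Im (cpoly (\<Prod>a\<in>#A. [:- a, 1:]) z / cpoly (\<Prod>a\<in>#B. [:- a, 1:]) z) > 0"
  shows "size (filter_mset (\<lambda>a. a > t) B) \<le> size (filter_mset (\<lambda>a. a > t) A)"
proof -
  define F where "F s = (\<Sum>a\<in>#A. root_angle s t a) - (\<Sum>a\<in>#B. root_angle s t a)" for s
  have cont: "continuous_on S F" for S
    unfolding F_def by (intro continuous_intros continuous_on_sum_root_angle)
  \<comment> \<open>At \<open>s = 0\<close> every root contributes \<open>pi / 2\<close>, and
    \<open>A\<close> has one root more than \<open>B\<close>.\<close>
  have F0: "F 0 = pi / 2" by (simp add: F_def root_angle_def size algebra_simps)
  have nz: "F s \<noteq> 0" if "s \<ge> 0" for s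
  proof (cases "s = 0")
    case False
    then have s: "s > 0" using that by simp
    obtain r r' where r: "r > 0" "r' > 0"
      and eq: "cpoly (\<Prod>a\<in>#A. [:- a, 1:]) (Complex t (1 / s)) = of_real r * cis (\<Sum>a\<in>#A. root_angle s t a)"
        "cpoly (\<Prod>a\<in>#B. [:- a, 1:]) (Complex t (1 / s)) = of_real r' * cis (\<Sum>a\<in>#B. root_angle s t a)"
      using cis_sum_root_angle[OF s] by metis
    have "Im (of_real (r / r') * cis (F s)) > 0"
      using Im[of "Complex t (1 / s)"] s unfolding eq F_def
      by (simp add: cis_divide[symmetric])
    then show ?thesis by auto
  qed (simp add: F0)
  have pos: "F s \<ge> 0" if "s \<ge> 0" for s
  proof (rule ccontr)
    assume "\<not> F s \<ge> 0"
    then have "\<exists>s'. 0 \<le> s' \<and> s' \<le> s \<and> F s' = 0"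
      using that by (intro IVT2' cont) (simp_all add: F0)
    then show False using nz by blast
  qed
  have "(F \<longlongrightarrow> pi * size (filter_mset (\<lambda>a. a > t) A) - pi * size (filter_mset (\<lambda>a. a > t) B)) at_top"
    unfolding F_def by (intro tendsto_diff sum_root_angle_tendsto t)
  then have "0 \<le> pi * size (filter_mset (\<lambda>a. a > t) A) - pi * size (filter_mset (\<lambda>a. a > t) B)"
    by (rule tendsto_lowerbound) (auto intro!: eventually_mono[OF eventually_ge_at_top[of 0]] pos)
  then have "0 \<le> pi * (real (size (filter_mset (\<lambda>a. a > t) A)) - size (filter_mset (\<lambda>a. a > t) B))"
    by (simp add: right_diff_distrib)
  then show ?thesis using pi_gt_zero by (auto simp: zero_le_mult_iff)
qed

section \<open>From counts above a threshold to sorted entries\<close>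

lemma nonincreasing_simps [simp]:
  "mset (nonincreasing X) = X" "length (nonincreasing X) = size X"
  "set (nonincreasing X) = set_mset X" "sorted_wrt (\<ge>) (nonincreasing X)"
  using sorted_sorted_list_of_multiset[of X]
  by (simp_all add: nonincreasing_def sorted_wrt_rev flip: size_mset)

text \<open>If the claim failed at \<open>i\<close>, a threshold strictly between the two entries
  would have more than \<open>i\<close> entries of \<open>B\<close> above it but at most
  \<open>i\<close> of \<open>A\<close>.\<close>

lemma nonincreasing_nth_mono:
  assumes count: "\<And>t. t \<notin># A \<Longrightarrow> t \<notin># B \<Longrightarrow>
      size (filter_mset (\<lambda>a. a > t) B) \<le> size (filter_mset (\<lambda>a. a > t) A)"
    and i: "i < size B" "size B \<le> size A"
  shows "nonincreasing B ! i \<le> nonincreasing A ! i"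
proof (rule ccontr)
  let ?a = "nonincreasing A" and ?b = "nonincreasing B"
  assume "\<not> ?b ! i \<le> ?a ! i"
  \<comment> \<open>The assumption \<open>count\<close> speaks only of thresholds that are not
    entries; an infinite interval contains one, as there are finitely many entries.\<close>
  then have "infinite {?a ! i<..<?b ! i}" by (simp add: infinite_Ioo)
  then have "infinite ({?a ! i<..<?b ! i} - (set_mset A \<union> set_mset B))" by (intro Diff_infinite_finite) auto
  then obtain t where "t \<in> {?a ! i<..<?b ! i} - (set_mset A \<union> set_mset B)"
    by (metis finite.emptyI ex_in_conv)
  then have t: "?a ! i < t" "t < ?b ! i" "t \<notin># A" "t \<notin># B" by simp_all
  have len: "size (filter_mset (\<lambda>a. a > t) X) = card {j. j < size X \<and> nonincreasing X ! j > t}" for X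
    by (metis length_filter_conv_card mset_filter nonincreasing_simps(1,2) size_mset)
  have "{j. j < size A \<and> ?a ! j > t} \<subseteq> {..<i}"
  proof (intro subsetI, rule ccontr)
    fix j assume "j \<in> {j. j < size A \<and> ?a ! j > t}" "j \<notin> {..<i}"
    then have j: "j < size A" "?a ! j > t" "i \<le> j" by simp_all
    then have "i = j \<or> ?a ! i \<ge> ?a ! j"
      using sorted_wrt_nth_less[of "(\<ge>)" ?a i j] by (auto simp: le_less[of i j] not_less)
    then show False using t j by auto
  qed
  then have "card {j. j < size A \<and> ?a ! j > t} \<le> i"
    by (metis card_lessThan card_mono finite_lessThan)
  \<comment> \<open>Indices start at 0, so these are \<open>Suc i\<close> positions, one more than
    the bound for \<open>A\<close>.\<close>
  moreover have "{..i} \<subseteq> {j. j < size B \<and> ?b ! j > t}"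
  proof
    fix j assume "j \<in> {..i}"
    then have "i = j \<or> ?b ! j \<ge> ?b ! i"
      using sorted_wrt_nth_less[of "(\<ge>)" ?b j i] i by (auto simp: le_less[of j i])
    then show "j \<in> {j. j < size B \<and> ?b ! j > t}" using t i \<open>j \<in> {..i}\<close> by auto
  qed
  then have "card {j. j < size B \<and> ?b ! j > t} \<ge> Suc i"
    using card_mono[of "{j. j < size B \<and> ?b ! j > t}" "{..i}"] by simp
  ultimately show False using count[OF t(3,4)] by (simp add: len)
qed

text \<open>Vieta's formulas for the top two coefficients, to be compared with those of the matching
  polynomial.\<close>

lemma linear_factors_coeffs:
  fixes A :: "real multiset"
  shows "degree (\<Prod>a\<in>#A. [:- a, 1:]) = size A \<and> lead_coeff (\<Prod>a\<in>#A. [:- a, 1:]) = 1 \<and>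
    (A \<noteq> {#} \<longrightarrow> coeff (\<Prod>a\<in>#A. [:- a, 1:]) (size A - 1) = - sum_mset A)"
proof (induction A)
  case (add a A)
  let ?q = "\<Prod>a\<in>#A. [:- a, 1:]"
  have "?q \<noteq> 0" using add by auto
  then have "degree ([:- a, 1:] * ?q) = Suc (size A)" "lead_coeff ([:- a, 1:] * ?q) = 1"
    using add by (simp add: degree_mult_eq del: mult_pCons_left)
      (use add in \<open>simp only: lead_coeff_mult; simp\<close>)
  moreover have "coeff ([:- a, 1:] * ?q) (size A) = - a - sum_mset A"
  proof (cases "size A")
    case 0
    then show ?thesis using add by simp
  next
    case (Suc n)
    then show ?thesis using add by auto
  qed
  ultimately show ?case by simp
qed simp

section \<open>Zeros under vertex deletion, and majorization\<close>

context
  fixes d :: "'a \<Rightarrow> real" and E :: "'a set set"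
  assumes fin: "finite E" and card2: "\<forall>e\<in>E. card e = 2"
begin

abbreviation "zeros T \<equiv> proots (weighted_matching_poly d E T)"

text \<open>Nonvanishing in the upper half-plane gives the factorization, and the leading
  coefficient is 1.\<close>

lemma weighted_matching_poly_eq_prod_zeros:
  assumes "finite T"
  shows "weighted_matching_poly d E T = (\<Prod>a\<in>#zeros T. [:- a, 1:])"
proof -
  note c = weighted_matching_poly_coeffs[OF fin card2 assms, of d]
  have "weighted_matching_poly d E T \<noteq> 0" using c by (metis coeff_0 zero_neq_one)
  then show ?thesis
    using real_rooted_decompose[of "weighted_matching_poly d E T"]
      weighted_matching_poly_Im_pos[OF fin card2 assms] c by simp
qed

lemma size_zeros: "finite T \<Longrightarrow> size (zeros T) = card T"
  by (metis weighted_matching_poly_coeffs[OF fin card2] weighted_matching_poly_eq_prod_zeros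
      linear_factors_coeffs)

lemma sum_zeros:
  assumes "finite T"
  shows "sum_mset (zeros T) = sum d T"
proof (cases "T = {}")
  case True
  then show ?thesis using size_zeros[of T] by simp
next
  case False
  then have "zeros T \<noteq> {#}" using size_zeros[OF assms] assms by auto
  then show ?thesis
    using weighted_matching_poly_coeffs[OF fin card2 assms, of d] False
      linear_factors_coeffs[of "zeros T"] weighted_matching_poly_eq_prod_zeros[OF assms]
      size_zeros[OF assms] by simp
qed

text \<open>The quotient of the two polynomials has positive imaginary part in the upper half-plane,
  so the comparison of arguments applies. This is one half of the interlacing of zeros.\<close>

lemma zeros_insert_mono:
  assumes "finite T" "v \<notin> T" "i < card T"
  shows "nonincreasing (zeros T) ! i \<le> nonincreasing (zeros (insert v T)) ! i"
proof (rule nonincreasing_nth_mono)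
  have sz: "size (zeros (insert v T)) = Suc (size (zeros T))" using assms by (simp add: size_zeros)
  then show "size (zeros T) \<le> size (zeros (insert v T))" by simp
  show "i < size (zeros T)" using assms by (simp add: size_zeros)
  fix t assume t: "t \<notin># zeros (insert v T)" "t \<notin># zeros T"
  show "size {#a \<in># zeros T. t < a#} \<le> size {#a \<in># zeros (insert v T). t < a#}"
  proof (rule count_roots_mono[OF sz t])
    fix z assume "Im z > 0"
    from weighted_matching_poly_Im_pos[OF fin card2 _ this, of "insert v T" d] assms
    show "Im (cpoly (\<Prod>a\<in>#zeros (insert v T). [:- a, 1:]) z / cpoly (\<Prod>a\<in>#zeros T. [:- a, 1:]) z) > 0"
      by (simp flip: weighted_matching_poly_eq_prod_zeros)
  qed
qed

lemma zeros_mono: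
  assumes "finite T" "S \<subseteq> T" "i < card S"
  shows "nonincreasing (zeros S) ! i \<le> nonincreasing (zeros T) ! i"
proof -
  \<comment> \<open>The vertices of \<open>T - S\<close> are added one at a time;
    \<open>i < card S\<close> keeps the index valid at every stage.\<close>
  have "nonincreasing (zeros S) ! i \<le> nonincreasing (zeros (S \<union> R)) ! i" if "finite R" "R \<inter> S = {}" for R
    using that
  proof (induction R)
    case (insert v R)
    have "i < card (S \<union> R)"
      using assms insert.hyps finite_subset card_mono[of "S \<union> R" S] by fastforce
    then show ?case
      using zeros_insert_mono[of "S \<union> R" v i] insert assms finite_subset[OF assms(2,1)] by fastforce
  qed simp
  from this[of "T - S"] show ?thesis using assms by (simp add: Un_absorb1 Diff_disjoint Int_commute)
qed

text \<open>The weights on \<open>S\<close> sum to the sum of all zeros for \<open>S\<close>, which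
  are dominated one by one by the largest zeros for \<open>T\<close>.\<close>

lemma sum_subset_le_top_zeros:
  assumes "finite T" "S \<subseteq> T"
  shows "sum d S \<le> sum_list (take (card S) (nonincreasing (zeros T)))"
proof -
  have finS: "finite S" using assms finite_subset by blast
  have le: "card S \<le> card T" using assms card_mono by blast
  have "sum d S = sum_list (nonincreasing (zeros S))"
    using sum_zeros[OF finS] by (simp flip: sum_mset_sum_list)
  also have "\<dots> = (\<Sum>i<card S. nonincreasing (zeros S) ! i)"
    by (simp add: sum_list_sum_nth size_zeros finS atLeast0LessThan)
  also have "\<dots> \<le> (\<Sum>i<card S. nonincreasing (zeros T) ! i)"
    by (intro sum_mono zeros_mono assms) auto
  also have "\<dots> = sum_list (take (card S) (nonincreasing (zeros T)))"
    using le by (simp add: sum_list_sum_nth size_zeros assms(1) atLeast0LessThan min_absorb2)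
  finally show ?thesis .
qed

lemma zeros_majorize:
  assumes "finite T"
  shows "majorizes (zeros T) (image_mset d (mset_set T))"
  unfolding majorizes_def
proof (intro conjI ballI)
  let ?X = "image_mset d (mset_set T)"
  show "size ?X = size (zeros T)" using assms by (simp add: size_zeros)
  show "sum_mset ?X = sum_mset (zeros T)" using assms by (simp add: sum_zeros sum_unfold_sum_mset)
  fix k assume k: "k \<in> {1..size ?X}"
  let ?L = "nonincreasing ?X"
  \<comment> \<open>The \<open>k\<close> largest weights must come from an actual vertex set: the
    split of the sorted list is pulled back along \<open>d\<close> to a split of the vertices, which
    also settles ties.\<close>
  have "?X = mset (take k ?L) + mset (drop k ?L)" by (simp flip: mset_append)
  then obtain B C where B: "mset_set T = B + C" "mset (take k ?L) = image_mset d B"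
    by (blast dest: image_mset_eq_plusD)
  define S where "S = set_mset B"
  \<comment> \<open>A part of \<open>mset_set T\<close> has no repeated elements, so
    \<open>B\<close> is the multiset of a set.\<close>
  have "count B x \<le> 1" for x
  proof -
    have "count B x \<le> count (mset_set T) x" by (simp add: B(1))
    also have "\<dots> \<le> 1" by (simp add: count_mset_set')
    finally show ?thesis .
  qed
  then have "count B x = (if x \<in># B then 1 else 0)" for x
    by (metis One_nat_def le_Suc_eq le_zero_eq count_eq_zero_iff)
  then have "B = mset_set S"
    by (intro multiset_eqI) (simp add: S_def count_mset_set')
  moreover have "size B = k" using arg_cong[OF B(2), of size] k by simp
  ultimately have "card S = k" "sum d S = sum_list (take k ?L)"
    using B(2) by (auto simp: sum_unfold_sum_mset simp flip: sum_mset_sum_list)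
  moreover have "S \<subseteq> T"
    using arg_cong[OF B(1), of set_mset] assms by (auto simp: S_def)
  ultimately show "sum_list (take k (nonincreasing ?X)) \<le> sum_list (take k (nonincreasing (zeros T)))"
    using sum_subset_le_top_zeros[OF assms] by metis
qed

end

theorem theorem3p5:
  fixes V :: "'a set" and E :: "'a set set"
  assumes "simple_graph V E"
  shows "majorizes (zero_sequence (laplacian_matching_poly V E)) (degree_sequence V E)"
proof -
  have "finite V" "\<forall>e\<in>E. card e = 2" "E \<subseteq> Pow V" using assms by (auto simp: simple_graph_def)
  moreover from this have "finite E" using finite_subset by blast
  ultimately show ?thesis
    using zeros_majorize[of E V]
    by (simp add: zero_sequence_def degree_sequence_def laplacian_matching_poly_eq_weighted[OF assms])
qed

end
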